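(* Let $P$ be a bounded and graded poset. Then \[\underline{H}_P(t)=G_{\sigma(P)}(t)=G_{\tau(P^* )}(t).\]
   Context: All posets are finite, bounded (least element $\widehat 0$, greatest element $\widehat 1$) and graded with rank function $\rho$, $\rho(\widehat 0)=0$; $\rho(P):=\rho(\widehat 1)$. Atoms are elements of rank $1$, coatoms elements of rank $\rho(P)-1$. The truncation $\tau(P)$ is $P$ with all coatoms removed; the dual truncation $\sigma(P)$ is $P$ with all atoms removed. The dual $P^*$ has the same elements with $x\le^* y$ iff $y\le x$ in $P$. Chow polynomial: let $\mu$ be the Möbius function of $P$. For $x\le y$ put $\chi_{[x,y]}(t)=\sum_{x\le z\le y}\mu(x,z)t^{\rho(y)-\rho(z)}$, and define $\overline{\chi}_{[x,x]}(t)=-1$ and $\overline{\chi}_{[x,y]}(t)=\chi_{[x,y]}(t)/(t-1)$ for $x<y$. Define $\underline{H}_{[x,x]}(t)=1$ and, for $x<y$, $\underline{H}_{[x,y]}(t)=\sum_{x<z\le y}\overline{\chi}_{[x,z]}(t)\,\underline{H}_{[z,y]}(t)$. The Chow polynomial is $\underline{H}_P(t):=\underline{H}_{[\widehat0,\widehat1]}(t)$. The (left) augmented Chow polynomial is $G_P(t):=\sum_{z\in P}t^{\rho(z)}\underline{H}_{[z,\widehat1]}(t)$. *)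

theory Defs
  imports "HOL-Computational_Algebra.Polynomial"
begin

text \<open>
  A poset is represented by its (reflexive) order relation \<open>P\<close>: the ground set is \<^term>\<open>Field P\<close>,
  \<open>x \<le> y\<close> is \<open>(x, y) \<in> P\<close>, the dual poset is the converse relation \<open>P\<inverse>\<close>, and the subposet
  induced on \<open>A\<close> is \<open>Restr P A\<close>.
\<close>

definition finite_poset :: "'a rel \<Rightarrow> bool" where
  "finite_poset P \<longleftrightarrow> finite (Field P) \<and> Partial_order P"

definition is_bot :: "'a rel \<Rightarrow> 'a \<Rightarrow> bool" where
  "is_bot P b \<longleftrightarrow> b \<in> Field P \<and> (\<forall>x\<in>Field P. (b, x) \<in> P)"

definition is_top :: "'a rel \<Rightarrow> 'a \<Rightarrow> bool" where
  "is_top P t \<longleftrightarrow> t \<in> Field P \<and> (\<forall>x\<in>Field P. (x, t) \<in> P)"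

definition bot_of :: "'a rel \<Rightarrow> 'a" where
  "bot_of P = (THE b. is_bot P b)"

definition top_of :: "'a rel \<Rightarrow> 'a" where
  "top_of P = (THE t. is_top P t)"

definition interval :: "'a rel \<Rightarrow> 'a \<Rightarrow> 'a \<Rightarrow> 'a set" where
  "interval P x y = {z. (x, z) \<in> P \<and> (z, y) \<in> P}"

definition covered_by :: "'a rel \<Rightarrow> 'a \<Rightarrow> 'a \<Rightarrow> bool" where
  "covered_by P x y \<longleftrightarrow> (x, y) \<in> P \<and> x \<noteq> y \<and> interval P x y = {x, y}"

definition rank_function :: "'a rel \<Rightarrow> ('a \<Rightarrow> nat) \<Rightarrow> bool" where
  "rank_function P \<rho> \<longleftrightarrow>
     (\<forall>b. is_bot P b \<longrightarrow> \<rho> b = 0) \<and> (\<forall>x y. covered_by P x y \<longrightarrow> \<rho> y = \<rho> x + 1)"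

definition bounded_graded_poset :: "'a rel \<Rightarrow> bool" where
  "bounded_graded_poset P \<longleftrightarrow>
     finite_poset P \<and> (\<exists>b. is_bot P b) \<and> (\<exists>t. is_top P t) \<and> (\<exists>\<rho>. rank_function P \<rho>)"

text \<open>
  In a finite poset with a least element, two rank functions agree on \<^term>\<open>Field P\<close>
  (lemma \<open>rank_function_unique\<close> below), so the choice only affects irrelevant values.
\<close>

definition rank_of :: "'a rel \<Rightarrow> 'a \<Rightarrow> nat" where
  "rank_of P = (SOME \<rho>. rank_function P \<rho>)"

lemma finite_interval: "finite_poset P \<Longrightarrow> finite (interval P x y)"
  unfolding finite_poset_def interval_def
  by (rule finite_subset[of _ "Field P"]) (auto simp: Field_def)

lemma interval_psubset:
  assumes "finite_poset P" "(x, y) \<in> P" "z \<in> interval P x y"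
  shows "z \<noteq> y \<Longrightarrow> interval P x z \<subset> interval P x y"
    and "z \<noteq> x \<Longrightarrow> interval P z y \<subset> interval P x y"
proof -
  have tr: "trans P" and an: "antisym P" and re: "refl_on (Field P) P"
    using assms(1) by (auto simp: finite_poset_def order_on_defs)
  have "(x, x) \<in> P" "(y, y) \<in> P"
    using assms(2) re by (auto simp: refl_on_def Field_def)
  then have xy: "x \<in> interval P x y" "y \<in> interval P x y"
    using assms(2) by (auto simp: interval_def)
  have z: "(x, z) \<in> P" "(z, y) \<in> P"
    using assms(3) by (auto simp: interval_def)
  show "interval P x z \<subset> interval P x y" if "z \<noteq> y"
  proof -
    have "y \<notin> interval P x z" using that z an by (auto simp: interval_def antisym_def)
    moreover have "interval P x z \<subseteq> interval P x y"
      using z tr by (auto simp: interval_def dest: transD)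
    ultimately show ?thesis using xy by blast
  qed
  show "interval P z y \<subset> interval P x y" if "z \<noteq> x"
  proof -
    have "x \<notin> interval P z y" using that z an by (auto simp: interval_def antisym_def)
    moreover have "interval P z y \<subseteq> interval P x y"
      using z tr by (auto simp: interval_def dest: transD)
    ultimately show ?thesis using xy by blast
  qed
qed

lemma rank_function_unique:
  assumes "finite_poset P" "is_bot P b" "rank_function P \<rho>" "rank_function P \<rho>'" "x \<in> Field P"
  shows "\<rho> x = \<rho>' x"
  using assms(5)
proof (induction "card (interval P b x)" arbitrary: x rule: less_induct)
  case less
  have bx: "(b, x) \<in> P" using assms(2) less.prems by (auto simp: is_bot_def)
  show ?case
  proof (cases "x = b")
    case True
    then show ?thesis using assms(2-4) by (auto simp: rank_function_def)
  next
    case False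
    define S where "S = interval P b x - {x}"
    have fin: "finite S" unfolding S_def using finite_interval[OF assms(1)] by simp
    have "(b, b) \<in> P" using assms(2) by (auto simp: is_bot_def)
    then have "b \<in> S" using bx False by (auto simp: S_def interval_def)
    then have ne: "(\<lambda>z. card (interval P b z)) ` S \<noteq> {}" by blast
    then have "Max ((\<lambda>z. card (interval P b z)) ` S) \<in> (\<lambda>z. card (interval P b z)) ` S"
      using fin by (intro Max_in) auto
    then obtain y where y: "y \<in> S"
      and "card (interval P b y) = Max ((\<lambda>z. card (interval P b z)) ` S)" by auto
    then have ymax: "card (interval P b z) \<le> card (interval P b y)" if "z \<in> S" for z
      using that fin by (simp add: Max_ge)
    have yx: "(y, x) \<in> P" "y \<noteq> x" "y \<in> interval P b x" using y by (auto simp: S_def interval_def)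
    have yF: "y \<in> Field P" using yx by (auto simp: Field_def)
    have "interval P y x \<subseteq> {y, x}"
    proof
      fix z assume z: "z \<in> interval P y x"
      show "z \<in> {y, x}"
      proof (rule ccontr)
        assume nz: "z \<notin> {y, x}"
        have zF: "z \<in> Field P" using z by (auto simp: interval_def Field_def)
        then have bz: "(b, z) \<in> P" using assms(2) by (auto simp: is_bot_def)
        have "z \<in> S" using nz z bz by (auto simp: S_def interval_def)
        have "y \<in> interval P b z" using z yx by (auto simp: interval_def)
        then have "interval P b y \<subset> interval P b z"
          using interval_psubset(1)[OF assms(1) bz] nz by blast
        then have "card (interval P b y) < card (interval P b z)"
          using finite_interval[OF assms(1)] by (simp add: psubset_card_mono)
        then show False using ymax[OF \<open>z \<in> S\<close>] by simp
      qed
    qed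
    moreover have "(x, x) \<in> P" "(y, y) \<in> P"
      using assms(1) yF less.prems by (auto simp: finite_poset_def order_on_defs refl_on_def)
    ultimately have "covered_by P y x" using yx by (auto simp: covered_by_def interval_def)
    moreover have "\<rho> y = \<rho>' y"
    proof (rule less.hyps[OF _ yF])
      show "card (interval P b y) < card (interval P b x)"
        using interval_psubset(1)[OF assms(1) bx yx(3) yx(2)] finite_interval[OF assms(1)]
        by (simp add: psubset_card_mono)
    qed
    ultimately show ?thesis using assms(3,4) by (auto simp: rank_function_def)
  qed
qed

definition atoms :: "'a rel \<Rightarrow> 'a set" where
  "atoms P = {x \<in> Field P. rank_of P x = 1}"

text \<open>
  The defining condition of coatoms is written additively: with truncated subtraction on
  \<^typ>\<open>nat\<close>, the unique element of a poset of rank 0 would wrongly count as a coatom.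
\<close>

definition coatoms :: "'a rel \<Rightarrow> 'a set" where
  "coatoms P = {x \<in> Field P. rank_of P x + 1 = rank_of P (top_of P)}"

definition truncation :: "'a rel \<Rightarrow> 'a rel" where
  "truncation P = Restr P (Field P - coatoms P)"

definition dual_truncation :: "'a rel \<Rightarrow> 'a rel" where
  "dual_truncation P = Restr P (Field P - atoms P)"

text \<open>
  The guards below only make the recursions total; for a finite poset \<open>P\<close> and \<open>(x, y) \<in> P\<close>
  they are satisfied.
\<close>

function mobius :: "'a rel \<Rightarrow> 'a \<Rightarrow> 'a \<Rightarrow> int" where
  "mobius P x y =
     (if finite_poset P \<and> (x, y) \<in> P
      then if x = y then 1 else - (\<Sum>z\<in>interval P x y - {y}. mobius P x z)
      else 0)"
  by pat_completeness auto
termination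
proof (relation "measure (\<lambda>(P, x, y). card (interval P x y))", goal_cases)
  case (2 P x y z)
  then have "interval P x z \<subset> interval P x y"
    by (intro interval_psubset(1)) auto
  with 2 show ?case by (simp add: finite_interval psubset_card_mono)
qed simp

declare mobius.simps [simp del]

definition chi_poly :: "'a rel \<Rightarrow> 'a \<Rightarrow> 'a \<Rightarrow> int poly" where
  "chi_poly P x y = (\<Sum>z\<in>interval P x y. monom (mobius P x z) (rank_of P y - rank_of P z))"

text \<open>
  For \<open>x < y\<close>, \<open>chi_poly P x y\<close> vanishes at 1, so the division by \<open>t - 1\<close> is exact.
\<close>

definition reduced_chi_poly :: "'a rel \<Rightarrow> 'a \<Rightarrow> 'a \<Rightarrow> int poly" where
  "reduced_chi_poly P x y = (if x = y then - 1 else chi_poly P x y div [:- 1, 1:])"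

function chow_interval :: "'a rel \<Rightarrow> 'a \<Rightarrow> 'a \<Rightarrow> int poly" where
  "chow_interval P x y =
     (if finite_poset P \<and> (x, y) \<in> P
      then if x = y then 1
           else (\<Sum>z\<in>interval P x y - {x}. reduced_chi_poly P x z * chow_interval P z y)
      else 0)"
  by pat_completeness auto
termination
proof (relation "measure (\<lambda>(P, x, y). card (interval P x y))", goal_cases)
  case (2 P x y z)
  then have "interval P z y \<subset> interval P x y"
    by (intro interval_psubset(2)) auto
  with 2 show ?case by (simp add: finite_interval psubset_card_mono)
qed simp

declare chow_interval.simps [simp del]

definition chow_poly :: "'a rel \<Rightarrow> int poly" where
  "chow_poly P = chow_interval P (bot_of P) (top_of P)"

definition augmented_chow_poly :: "'a rel \<Rightarrow> int poly" where
  "augmented_chow_poly P = (\<Sum>z\<in>Field P. monom 1 (rank_of P z) * chow_interval P z (top_of P))"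

end

theory Submission
  imports Defs
begin

text \<open>
  In the incidence algebra of \<open>P\<close>, let \<open>\<zeta>'(x,y) = t^(\<rho>(y) - \<rho>(x))\<close>. The defining recursion says that
  \<open>H\<close> is the inverse of \<open>-\<chi>'\<close>, where \<open>\<chi>'\<close> is the reduced characteristic polynomial and
  \<open>(t - 1) \<chi>' = \<mu> \<zeta>' - t \<delta>\<close>. Hence \<open>G = \<zeta>' H\<close> is the inverse of the kernel
  \<open>K(x,y) = \<mu>(x,y) (1 + t + ... + t^(\<rho>(y) - \<rho>(x)))\<close>, which is invariant under duality; this gives
  \<open>G\<^sub>Q = G\<^sub>Q\<^sub>*\<close>, applied to \<open>Q = \<sigma>(P)\<close> with \<open>\<tau>(P\<^sup>*) = \<sigma>(P)\<^sup>*\<close>.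

  For the first equality, write \<open>[n] = 1 + ... + t^(n-1)\<close>. Expanding \<open>K G = \<delta>\<close> at the bottom gives
  \<open>H\<^sub>P = - \<Sum> \<mu>(0,z) [\<rho>(z)] G(z,1)\<close> over \<open>z > 0\<close> and the same formula for \<open>G\<close> of \<open>\<sigma>(P)\<close>, with the
  Moebius function of \<open>\<sigma>(P)\<close>. Since the latter is \<open>\<mu>(0,z) + \<Sum> \<mu>(a,z)\<close> over the atoms \<open>a\<close>,
  the difference is a sum over the atoms of the entries \<open>(K G)(a,1) = 0\<close>.
\<close>

section \<open>Convolution over a finite index set, that is, matrix multiplication\<close>

definition conv :: "'a set \<Rightarrow> ('a \<Rightarrow> 'a \<Rightarrow> 'b) \<Rightarrow> ('a \<Rightarrow> 'a \<Rightarrow> 'b) \<Rightarrow> 'a \<Rightarrow> 'a \<Rightarrow> 'b::comm_ring_1"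
  where "conv S f g x y = (\<Sum>z\<in>S. f x z * g z y)"

definition delta :: "'a \<Rightarrow> 'a \<Rightarrow> 'b::comm_ring_1" where
  "delta x y = (if x = y then 1 else 0)"

lemma conv_assoc: "conv S (conv S f g) h = conv S f (conv S g h)"
proof (intro ext)
  fix x y
  have "conv S (conv S f g) h x y = (\<Sum>z\<in>S. \<Sum>w\<in>S. f x w * g w z * h z y)"
    by (simp add: conv_def sum_distrib_right)
  also have "\<dots> = (\<Sum>w\<in>S. \<Sum>z\<in>S. f x w * g w z * h z y)"
    by (rule sum.swap)
  finally show "conv S (conv S f g) h x y = conv S f (conv S g h) x y"
    by (simp add: conv_def sum_distrib_left mult.assoc)
qed

lemma conv_cong:
  assumes "\<And>z. z \<in> S \<Longrightarrow> f x z = f' x z" "\<And>z. z \<in> S \<Longrightarrow> g z y = g' z y"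
  shows "conv S f g x y = conv S f' g' x y"
  using assms by (simp add: conv_def)

lemma conv_delta_left: "finite S \<Longrightarrow> x \<in> S \<Longrightarrow> conv S delta g x y = g x y"
  by (simp add: conv_def delta_def if_distrib[of "\<lambda>c. c * _"] cong: if_cong)

lemma conv_delta_right: "finite S \<Longrightarrow> y \<in> S \<Longrightarrow> conv S f delta x y = f x y"
  by (simp add: conv_def delta_def if_distrib[of "\<lambda>c. _ * c"] cong: if_cong)

text \<open>By associativity \<open>f = f (g h) = (f g) h = h\<close>. Both duality results,
  \<open>mobius_converse\<close> and \<open>aug_interval_converse\<close>, are obtained this
  way.\<close>

lemma conv_left_inverse_eq_right_inverse:
  assumes fin: "finite S" and x: "x \<in> S" and y: "y \<in> S"
    and fg: "\<And>u v. u \<in> S \<Longrightarrow> v \<in> S \<Longrightarrow> conv S f g u v = delta u v"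
    and gh: "\<And>u v. u \<in> S \<Longrightarrow> v \<in> S \<Longrightarrow> conv S g h u v = delta u v"
  shows "f x y = h x y"
proof -
  have "f x y = conv S f delta x y"
    using fin y by (simp add: conv_delta_right)
  also have "\<dots> = conv S f (conv S g h) x y"
    using gh y by (intro conv_cong) auto
  also have "\<dots> = conv S (conv S f g) h x y"
    by (simp add: conv_assoc)
  also have "\<dots> = conv S delta h x y"
    using fg x by (intro conv_cong) auto
  also have "\<dots> = h x y"
    using fin x by (simp add: conv_delta_left)
  finally show ?thesis .
qed

text \<open>The q-analogue \<open>(t^n - 1) / (t - 1)\<close> of \<open>n\<close>, with the
  polynomial variable t in the role of q.\<close>

definition q_int :: "nat \<Rightarrow> int poly" where
  "q_int n = (\<Sum>i<n. monom 1 i)"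

lemma q_int_simps [simp]:
  "q_int 0 = 0" "q_int (Suc 0) = 1" "q_int (Suc n) = q_int n + monom 1 n"
  by (simp_all add: q_int_def)

lemma q_int_mult: "[:- 1, 1:] * q_int n = monom 1 n - 1"
proof (induction n)
  case (Suc n)
  have "[:- 1, 1:] * monom 1 n = (monom 1 (Suc n) - monom 1 n :: int poly)"
    by (simp add: monom_Suc)
  then show ?case using Suc by (simp only: q_int_simps distrib_left diff_add_cancel add_diff_eq)
qed simp

section \<open>Covers and strict monotonicity of rank functions\<close>

lemma exists_covered_by:
  assumes "finite_poset P" "(x, y) \<in> P" "x \<noteq> y"
  shows "\<exists>w. (x, w) \<in> P \<and> covered_by P w y"
  using assms(2,3)
proof (induction "card (interval P x y)" arbitrary: x rule: less_induct)
  case less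
  have tr: "trans P" and re: "refl_on (Field P) P"
    using assms(1) by (auto simp: finite_poset_def order_on_defs)
  have xx: "(x, x) \<in> P" "(y, y) \<in> P"
    using less.prems re by (auto simp: refl_on_def Field_def)
  show ?case
  proof (cases "covered_by P x y")
    case False
    then obtain z where z: "z \<in> interval P x y" "z \<noteq> x" "z \<noteq> y"
      using less.prems xx by (auto simp: covered_by_def interval_def)
    have "card (interval P z y) < card (interval P x y)"
      using interval_psubset(2)[OF assms(1) less.prems(1) z(1,2)] finite_interval[OF assms(1)]
      by (simp add: psubset_card_mono)
    with z obtain w where "(z, w) \<in> P" "covered_by P w y"
      using less.hyps[of z] by (auto simp: interval_def)
    then show ?thesis using z tr by (auto simp: interval_def dest: transD)
  qed (use xx in auto)
qed

text \<open>A rank function is constrained only along covers, so the induction splits off a last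
  cover \<open>w < y\<close> lying above \<open>x\<close>.\<close>

lemma rank_function_strict_mono:
  assumes "finite_poset P" "rank_function P \<rho>" "(x, y) \<in> P" "x \<noteq> y"
  shows "\<rho> x < \<rho> y"
  using assms(3,4)
proof (induction "card (interval P x y)" arbitrary: y rule: less_induct)
  case less
  obtain w where w: "(x, w) \<in> P" "covered_by P w y"
    using exists_covered_by[OF assms(1) less.prems] by blast
  then have wy: "w \<in> interval P x y" "w \<noteq> y" and rk: "\<rho> y = \<rho> w + 1"
    using assms(2) by (auto simp: covered_by_def interval_def rank_function_def)
  have "card (interval P x w) < card (interval P x y)"
    using interval_psubset(1)[OF assms(1) less.prems(1) wy] finite_interval[OF assms(1)]
    by (simp add: psubset_card_mono)
  then show ?case using less.hyps[of w] w(1) rk by (cases "x = w") auto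
qed

section \<open>Rank-weighted incidence functions\<close>

definition rzeta :: "'a rel \<Rightarrow> 'a \<Rightarrow> 'a \<Rightarrow> int poly" where
  "rzeta P x y = (if (x, y) \<in> P then monom 1 (rank_of P y - rank_of P x) else 0)"

definition rmobius :: "'a rel \<Rightarrow> 'a \<Rightarrow> 'a \<Rightarrow> int poly" where
  "rmobius P x y = monom (mobius P x y) (rank_of P y - rank_of P x)"

text \<open>Extends the augmented Chow polynomial to every interval of \<open>P\<close>, so that it
  becomes an incidence function with an inverse.\<close>

definition aug_interval :: "'a rel \<Rightarrow> 'a \<Rightarrow> 'a \<Rightarrow> int poly" where
  "aug_interval P = conv (Field P) (rzeta P) (chow_interval P)"

text \<open>The kernel \<open>K\<close> of the overview. Truncated subtraction does no harm: off the
  order relation \<open>mobius\<close> is 0.\<close>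

definition aug_kernel :: "'a rel \<Rightarrow> 'a \<Rightarrow> 'a \<Rightarrow> int poly" where
  "aug_kernel P x y = smult (mobius P x y) (q_int (Suc (rank_of P y - rank_of P x)))"

section \<open>Order, bounds and rank in a bounded graded poset\<close>

locale bounded_graded =
  fixes P :: "'a rel"
  assumes bounded_graded_poset: "bounded_graded_poset P"
begin

abbreviation "\<rho> \<equiv> rank_of P"

lemma finite_poset: "finite_poset P"
  using bounded_graded_poset by (simp add: bounded_graded_poset_def)

lemma finite_Field [simp]: "finite (Field P)"
  using finite_poset by (simp add: finite_poset_def)

lemma refl: "x \<in> Field P \<Longrightarrow> (x, x) \<in> P"
  using finite_poset by (auto simp: finite_poset_def order_on_defs refl_on_def)

lemma trans: "(x, y) \<in> P \<Longrightarrow> (y, z) \<in> P \<Longrightarrow> (x, z) \<in> P"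
  using finite_poset by (auto simp: finite_poset_def order_on_defs dest: transD)

lemma antisym: "(x, y) \<in> P \<Longrightarrow> (y, x) \<in> P \<Longrightarrow> x = y"
  using finite_poset by (auto simp: finite_poset_def order_on_defs dest: antisymD)

lemma interval_subset_Field: "interval P x y \<subseteq> Field P"
  by (auto simp: interval_def Field_def)

lemma bot_of_eq: "is_bot P b \<Longrightarrow> bot_of P = b"
  unfolding bot_of_def by (rule the_equality) (auto simp: is_bot_def intro: antisym)

lemma top_of_eq: "is_top P b \<Longrightarrow> top_of P = b"
  unfolding top_of_def by (rule the_equality) (auto simp: is_top_def intro: antisym)

lemma is_bot_bot_of: "is_bot P (bot_of P)"
  using bounded_graded_poset bot_of_eq by (auto simp: bounded_graded_poset_def)

lemma is_top_top_of: "is_top P (top_of P)"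
  using bounded_graded_poset top_of_eq by (auto simp: bounded_graded_poset_def)

lemma bot_in_Field [simp]: "bot_of P \<in> Field P" and bot_least: "x \<in> Field P \<Longrightarrow> (bot_of P, x) \<in> P"
  using is_bot_bot_of by (auto simp: is_bot_def)

lemma top_in_Field [simp]: "top_of P \<in> Field P" and top_greatest: "x \<in> Field P \<Longrightarrow> (x, top_of P) \<in> P"
  using is_top_top_of by (auto simp: is_top_def)

lemma rank_function_rank_of: "rank_function P \<rho>"
  using bounded_graded_poset unfolding bounded_graded_poset_def rank_of_def
  by (metis someI_ex)

text \<open>Since \<open>rank_of\<close> is a choice, ranks in the converse and in the dual
  truncation are computed by exhibiting some rank function and applying this lemma.\<close>

lemma rank_of_eq: "rank_function P r \<Longrightarrow> x \<in> Field P \<Longrightarrow> \<rho> x = r x"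
  using rank_function_unique[OF finite_poset is_bot_bot_of rank_function_rank_of] .

lemma rank_bot [simp]: "\<rho> (bot_of P) = 0"
  using rank_function_rank_of is_bot_bot_of by (auto simp: rank_function_def)

lemma rank_strict_mono: "(x, y) \<in> P \<Longrightarrow> x \<noteq> y \<Longrightarrow> \<rho> x < \<rho> y"
  using rank_function_strict_mono[OF finite_poset rank_function_rank_of] .

lemma rank_mono: "(x, y) \<in> P \<Longrightarrow> \<rho> x \<le> \<rho> y"
  using rank_strict_mono[of x y] by (cases "x = y") auto

lemma rank_eq_0_iff: "x \<in> Field P \<Longrightarrow> \<rho> x = 0 \<longleftrightarrow> x = bot_of P"
  using rank_strict_mono[OF bot_least, of x] rank_bot by fastforce

section \<open>Moebius inversion, plain and rank-weighted\<close>

lemma mobius_eq_0: "(x, y) \<notin> P \<Longrightarrow> mobius P x y = 0"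
  by (subst mobius.simps) simp

lemma mobius_self [simp]: "x \<in> Field P \<Longrightarrow> mobius P x x = 1"
  by (subst mobius.simps) (simp add: finite_poset refl)

lemma sum_mobius_interval:
  assumes "(x, y) \<in> P"
  shows "(\<Sum>z\<in>interval P x y. mobius P x z) = delta x y"
proof (cases "x = y")
  case True
  have "x \<in> Field P" using assms by (auto simp: Field_def)
  moreover have "interval P x x = {x}"
    using assms True antisym by (auto simp: interval_def)
  ultimately show ?thesis using True by (simp add: delta_def)
next
  case False
  have "y \<in> interval P x y"
    using assms refl[of y] by (auto simp: interval_def Field_def)
  then have "(\<Sum>z\<in>interval P x y. mobius P x z)
      = mobius P x y + (\<Sum>z\<in>interval P x y - {y}. mobius P x z)"
    by (simp add: sum.remove finite_interval finite_poset)
  also have "mobius P x y = - (\<Sum>z\<in>interval P x y - {y}. mobius P x z)"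
    using assms False by (subst mobius.simps) (simp add: finite_poset)
  finally show ?thesis using False by (simp add: delta_def)
qed

text \<open>Links the given definitions, which sum over intervals, to \<open>conv\<close>, which
  sums over the whole ground set.\<close>

lemma sum_Field_eq_sum_interval:
  assumes "\<And>z. z \<in> Field P \<Longrightarrow> \<not> ((x, z) \<in> P \<and> (z, y) \<in> P) \<Longrightarrow> f z = 0"
  shows "(\<Sum>z\<in>Field P. f z) = (\<Sum>z\<in>interval P x y. f z)"
  using assms interval_subset_Field[of x y]
  by (intro sum.mono_neutral_right) (auto simp: interval_def)

lemma delta_eq_0: "x \<in> Field P \<Longrightarrow> (x, y) \<notin> P \<Longrightarrow> delta x y = 0"
  using refl by (auto simp: delta_def)

lemma mobius_zeta:
  assumes "x \<in> Field P"
  shows "conv (Field P) (mobius P) (\<lambda>x y. if (x, y) \<in> P then 1 else 0) x y = delta x y"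
proof -
  have "conv (Field P) (mobius P) (\<lambda>x y. if (x, y) \<in> P then 1 else 0) x y
      = (\<Sum>z\<in>interval P x y. mobius P x z)"
    unfolding conv_def
    by (subst sum_Field_eq_sum_interval) (auto simp: mobius_eq_0 interval_def intro!: sum.cong)
  also have "\<dots> = delta x y"
  proof (cases "(x, y) \<in> P")
    case False
    then have "interval P x y = {}" using trans by (auto simp: interval_def)
    then show ?thesis using False assms by (simp add: delta_eq_0)
  qed (rule sum_mobius_interval)
  finally show ?thesis .
qed

text \<open>Along \<open>x \<le> z \<le> y\<close> the exponents add up to
  \<open>\<rho> y - \<rho> x\<close>, independently of \<open>z\<close>, so the weight factors out
  of \<open>mobius_zeta\<close>. On the diagonal this exponent is 0.\<close>

lemma rmobius_rzeta:
  assumes "x \<in> Field P"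
  shows "conv (Field P) (rmobius P) (rzeta P) x y = delta x y"
proof -
  have "rmobius P x z * rzeta P z y =
      monom (mobius P x z * (if (z, y) \<in> P then 1 else 0)) (\<rho> y - \<rho> x)" for z
    using rank_mono[of x z] rank_mono[of z y]
    by (cases "(x, z) \<in> P") (auto simp: rmobius_def rzeta_def mult_monom mobius_eq_0)
  then have "conv (Field P) (rmobius P) (rzeta P) x y
     = monom (conv (Field P) (mobius P) (\<lambda>x y. if (x, y) \<in> P then 1 else 0) x y) (\<rho> y - \<rho> x)"
    by (simp add: conv_def monom_sum)
  then show ?thesis using assms by (simp add: mobius_zeta) (simp add: delta_def)
qed

section \<open>The Chow polynomial as an inverse of the reduced characteristic polynomial\<close>

lemma chi_poly_eq:
  "chi_poly P x y = (\<Sum>z\<in>Field P. [:mobius P x z:] * rzeta P z y)"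
  unfolding chi_poly_def
  by (subst sum_Field_eq_sum_interval[of x y])
     (auto simp: mobius_eq_0 rzeta_def interval_def smult_monom intro!: sum.cong)

text \<open>For \<open>x < y\<close> the value of \<open>chi_poly\<close> at 1 is a full Moebius
  sum, hence 0, and the division is exact. On the diagonal the convention -1 gives
  \<open>1 - t\<close>, which matches the right-hand side.\<close>

lemma reduced_chi_poly_mult:
  assumes "x \<in> Field P"
  shows "[:- 1, 1:] * reduced_chi_poly P x y = chi_poly P x y - [:0, 1:] * delta x y"
proof (cases "x = y")
  case True
  have "interval P x x = {x}" using assms antisym refl by (auto simp: interval_def)
  then have "chi_poly P x x = 1" using assms by (simp add: chi_poly_def)
  then show ?thesis using True by (simp add: reduced_chi_poly_def delta_def one_pCons)
next
  case False
  have "poly (chi_poly P x y) 1 = (\<Sum>z\<in>interval P x y. mobius P x z)"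
    by (simp add: chi_poly_def poly_sum poly_monom)
  also have "\<dots> = 0"
  proof (cases "(x, y) \<in> P")
    case False
    then have "interval P x y = {}" using trans by (auto simp: interval_def)
    then show ?thesis by simp
  qed (use False in \<open>simp add: sum_mobius_interval delta_def\<close>)
  finally have "[:- 1, 1:] dvd chi_poly P x y"
    by (simp add: poly_eq_0_iff_dvd)
  then have "[:- 1, 1:] * (chi_poly P x y div [:- 1, 1:]) = chi_poly P x y"
    by (rule dvd_mult_div_cancel)
  then show ?thesis using False
    by (simp only: reduced_chi_poly_def delta_def if_False mult_zero_right diff_zero)
qed

lemma reduced_chi_poly_eq_0:
  assumes "x \<in> Field P" "(x, z) \<notin> P"
  shows "reduced_chi_poly P x z = 0"
proof -
  have "interval P x z = {}" using assms trans by (auto simp: interval_def)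
  then show ?thesis using assms refl by (auto simp: reduced_chi_poly_def chi_poly_def)
qed

text \<open>The diagonal value -1 of \<open>reduced_chi_poly\<close> moves the left side of the Chow
  recursion into the sum as its term for \<open>z = x\<close>.\<close>

lemma reduced_chi_poly_chow:
  assumes "x \<in> Field P"
  shows "conv (Field P) (reduced_chi_poly P) (chow_interval P) x y = - delta x y"
proof (cases "(x, y) \<in> P")
  case False
  then have "chow_interval P z y = 0" if "(x, z) \<in> P" for z
    using that trans by (subst chow_interval.simps) auto
  moreover have "reduced_chi_poly P x z = 0" if "(x, z) \<notin> P" for z
    using assms that by (rule reduced_chi_poly_eq_0)
  ultimately have "conv (Field P) (reduced_chi_poly P) (chow_interval P) x y = 0"
    unfolding conv_def by (intro sum.neutral) (metis mult_eq_0_iff)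
  then show ?thesis using False assms by (simp add: delta_eq_0)
next
  case True
  have x: "x \<in> interval P x y" using True assms refl by (auto simp: interval_def)
  have "chow_interval P z y = 0" if "(z, y) \<notin> P" for z
    using that by (subst chow_interval.simps) auto
  moreover have "reduced_chi_poly P x z = 0" if "(x, z) \<notin> P" for z
    using assms that by (rule reduced_chi_poly_eq_0)
  ultimately have "conv (Field P) (reduced_chi_poly P) (chow_interval P) x y
     = (\<Sum>z\<in>interval P x y. reduced_chi_poly P x z * chow_interval P z y)"
    unfolding conv_def by (intro sum_Field_eq_sum_interval) auto
  also have "\<dots> = - chow_interval P x y +
      (\<Sum>z\<in>interval P x y - {x}. reduced_chi_poly P x z * chow_interval P z y)"
    using x by (simp add: sum.remove finite_interval finite_poset reduced_chi_poly_def)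
  \<comment> \<open>For \<open>x = y\<close> the remaining sum is empty; otherwise it is the
    recursion for \<open>chow_interval P x y\<close> and cancels the first summand.\<close>
  also have "\<dots> = - delta x y"
  proof (cases "x = y")
    case xy: True
    then have "interval P x y = {x}" using assms antisym refl by (auto simp: interval_def)
    then show ?thesis using xy True
      by (subst chow_interval.simps) (simp add: finite_poset delta_def)
  qed (use True in \<open>subst chow_interval.simps, simp add: finite_poset delta_def\<close>)
  finally show ?thesis .
qed

section \<open>The kernel and its inverse, the augmented Chow polynomials of intervals\<close>

lemma aug_kernel_rzeta:
  assumes "x \<in> Field P" "y \<in> Field P"
  shows "conv (Field P) (aug_kernel P) (rzeta P) x y = - reduced_chi_poly P x y"
proof -
  \<comment> \<open>Multiplication by \<open>t - 1\<close> collapses the q-integer and turns the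
    kernel into t times \<open>rmobius\<close> minus \<open>mobius\<close>. Convolved with
    \<open>rzeta\<close>, the two parts become t times \<open>delta\<close> and
    \<open>chi_poly\<close>; the factor \<open>t - 1\<close> is cancelled at the end.\<close>
  have "[:- 1, 1:] * (aug_kernel P x z * rzeta P z y)
      = [:0, 1:] * (rmobius P x z * rzeta P z y) - [:mobius P x z:] * rzeta P z y" for z
  proof -
    have "[:- 1, 1:] * aug_kernel P x z = smult (mobius P x z) (monom 1 (Suc (\<rho> z - \<rho> x)) - 1)"
      by (simp only: aug_kernel_def mult_smult_right q_int_mult)
    also have "\<dots> = [:0, 1:] * rmobius P x z - [:mobius P x z:]"
      by (simp add: rmobius_def smult_diff_right smult_monom monom_Suc)
    finally show ?thesis by (metis left_diff_distrib mult.assoc)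
  qed
  then have "[:- 1, 1:] * conv (Field P) (aug_kernel P) (rzeta P) x y
     = [:0, 1:] * conv (Field P) (rmobius P) (rzeta P) x y - chi_poly P x y"
    by (simp only: conv_def sum_distrib_left sum_subtractf chi_poly_eq)
  also have "\<dots> = [:- 1, 1:] * (- reduced_chi_poly P x y)"
    using assms by (simp only: rmobius_rzeta mult_minus_right reduced_chi_poly_mult minus_diff_eq)
  finally show ?thesis by (subst (asm) mult_cancel_left) simp
qed

text \<open>In the notation of the overview,
  \<open>K G = K \<zeta>' H = - \<chi>' H = \<delta>\<close>.\<close>

lemma aug_kernel_aug_interval:
  assumes "x \<in> Field P"
  shows "conv (Field P) (aug_kernel P) (aug_interval P) x y = delta x y"
proof -
  have "conv (Field P) (aug_kernel P) (aug_interval P) x y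
     = conv (Field P) (conv (Field P) (aug_kernel P) (rzeta P)) (chow_interval P) x y"
    by (simp add: aug_interval_def conv_assoc)
  also have "\<dots> = - conv (Field P) (reduced_chi_poly P) (chow_interval P) x y"
    using assms by (simp add: conv_def[of _ _ "chow_interval P"] aug_kernel_rzeta sum_negf)
  finally show ?thesis using assms by (simp add: reduced_chi_poly_chow)
qed

text \<open>Inverts \<open>G = \<zeta>' H\<close>, which lets \<open>chow_poly_eq\<close> express
  \<open>H\<close> through \<open>G\<close>.\<close>

lemma chow_interval_eq_rmobius_aug:
  assumes "x \<in> Field P"
  shows "chow_interval P x y = conv (Field P) (rmobius P) (aug_interval P) x y"
proof -
  have "conv (Field P) (rmobius P) (aug_interval P) x y
     = conv (Field P) (conv (Field P) (rmobius P) (rzeta P)) (chow_interval P) x y"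
    by (simp add: aug_interval_def conv_assoc)
  also have "\<dots> = conv (Field P) delta (chow_interval P) x y"
    using assms by (intro conv_cong) (auto simp: rmobius_rzeta)
  finally show ?thesis using assms by (simp add: conv_delta_left)
qed

lemma augmented_chow_poly_eq:
  "augmented_chow_poly P = aug_interval P (bot_of P) (top_of P)"
  by (simp add: augmented_chow_poly_def aug_interval_def conv_def rzeta_def bot_least)

lemma aug_interval_self:
  assumes "x \<in> Field P"
  shows "aug_interval P x x = 1"
proof -
  have "rzeta P x z * chow_interval P z x = (if z = x then 1 else 0)" if "z \<in> Field P" for z
    using that assms antisym[of x z]
    by (subst chow_interval.simps) (auto simp: rzeta_def refl finite_poset)
  then show ?thesis using assms by (simp add: aug_interval_def conv_def)
qed


section \<open>Duality\<close>

lemma is_bot_converse: "is_bot (P\<inverse>) = is_top P" and is_top_converse: "is_top (P\<inverse>) = is_bot P"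
  by (auto simp: is_bot_def is_top_def fun_eq_iff)

lemma covered_by_converse: "covered_by (P\<inverse>) x y \<longleftrightarrow> covered_by P y x"
  by (auto simp: covered_by_def interval_def)

lemma rank_function_converse: "rank_function (P\<inverse>) (\<lambda>x. \<rho> (top_of P) - \<rho> x)"
  unfolding rank_function_def is_bot_converse covered_by_converse
proof (intro conjI allI impI)
  fix x y assume "covered_by P y x"
  then have "\<rho> x = \<rho> y + 1" "x \<in> Field P"
    using rank_function_rank_of by (auto simp: rank_function_def covered_by_def Field_def)
  moreover have "\<rho> x \<le> \<rho> (top_of P)"
    using \<open>x \<in> Field P\<close> by (intro rank_mono top_greatest)
  ultimately show "\<rho> (top_of P) - \<rho> y = \<rho> (top_of P) - \<rho> x + 1"
    by simp
qed (auto dest: top_of_eq)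

lemma bounded_graded_converse: "bounded_graded (P\<inverse>)"
  unfolding bounded_graded_def bounded_graded_poset_def is_bot_converse is_top_converse
  using is_bot_bot_of is_top_top_of rank_function_converse finite_poset
  by (auto simp: finite_poset_def partial_order_on_def preorder_on_def refl_on_def)

lemma bot_of_converse: "bot_of (P\<inverse>) = top_of P"
  and top_of_converse: "top_of (P\<inverse>) = bot_of P"
  by (simp_all add: bot_of_def top_of_def is_bot_converse is_top_converse)

lemma rank_of_converse: "x \<in> Field P \<Longrightarrow> rank_of (P\<inverse>) x = \<rho> (top_of P) - \<rho> x"
  using bounded_graded.rank_of_eq[OF bounded_graded_converse rank_function_converse] by simp

lemma rank_of_converse_diff:
  "(x, y) \<in> P \<Longrightarrow> rank_of (P\<inverse>) x - rank_of (P\<inverse>) y = \<rho> y - \<rho> x"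
  using rank_mono[of x y] rank_mono[OF top_greatest, of y]
  by (auto simp: rank_of_converse FieldI1 FieldI2)

text \<open>Transposition reverses products, so \<open>mobius_zeta\<close> for the converse yields a
  right inverse of the zeta function of \<open>P\<close>; \<open>mobius P\<close> is a left inverse,
  and the two must agree.\<close>

lemma zeta_mobius_converse:
  assumes "y \<in> Field P"
  shows "conv (Field P) (\<lambda>x y. if (x, y) \<in> P then 1 else 0) (\<lambda>x y. mobius (P\<inverse>) y x) x y
    = delta x y"
  using bounded_graded.mobius_zeta[OF bounded_graded_converse, of y x] assms
  by (simp add: conv_def mult.commute delta_def eq_commute)

lemma mobius_converse:
  assumes "x \<in> Field P" "y \<in> Field P"
  shows "mobius (P\<inverse>) y x = mobius P x y"
  using conv_left_inverse_eq_right_inverse[OF finite_Field assms, OF mobius_zeta zeta_mobius_converse]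
  by simp

lemma zeta_mobius:
  assumes "x \<in> Field P" "y \<in> Field P"
  shows "conv (Field P) (\<lambda>x y. if (x, y) \<in> P then 1 else 0) (mobius P) x y = delta x y"
  using zeta_mobius_converse[OF assms(2), of x] assms
  by (simp add: conv_def mobius_converse)

lemma aug_kernel_converse:
  assumes "x \<in> Field P" "y \<in> Field P"
  shows "aug_kernel (P\<inverse>) y x = aug_kernel P x y"
  using assms by (cases "(x, y) \<in> P")
    (auto simp: aug_kernel_def mobius_converse mobius_eq_0 rank_of_converse_diff)

text \<open>The kernel is invariant under transposition. Hence the transposed \<open>G\<close> of
  the converse is a left inverse of \<open>K\<close>, while \<open>G\<close> itself is a right
  inverse.\<close>

lemma aug_interval_converse:
  assumes "x \<in> Field P" "y \<in> Field P"
  shows "aug_interval (P\<inverse>) y x = aug_interval P x y"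
proof (rule conv_left_inverse_eq_right_inverse[where S = "Field P" and g = "aug_kernel P"
      and f = "\<lambda>x y. aug_interval (P\<inverse>) y x"])
  fix u v assume uv: "u \<in> Field P" "v \<in> Field P"
  have "conv (Field P) (\<lambda>x y. aug_interval (P\<inverse>) y x) (aug_kernel P) u v
      = conv (Field P) (aug_kernel (P\<inverse>)) (aug_interval (P\<inverse>)) v u"
    using uv by (simp add: conv_def aug_kernel_converse mult.commute)
  also have "\<dots> = delta u v"
    using bounded_graded.aug_kernel_aug_interval[OF bounded_graded_converse, of v u] uv
    by (simp add: delta_def eq_commute)
  finally show "conv (Field P) (\<lambda>x y. aug_interval (P\<inverse>) y x) (aug_kernel P) u v = delta u v" .
qed (use assms aug_kernel_aug_interval in auto)

lemma augmented_chow_poly_converse: "augmented_chow_poly (P\<inverse>) = augmented_chow_poly P"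
  by (simp add: augmented_chow_poly_eq bounded_graded.augmented_chow_poly_eq[OF bounded_graded_converse]
      bot_of_converse top_of_converse aug_interval_converse)

lemma truncation_converse: "truncation (P\<inverse>) = (dual_truncation P)\<inverse>"
proof -
  \<comment> \<open>This bound makes the subtraction in \<open>rank_of_converse\<close> a true
    difference, so that coatoms of the converse are exactly the elements of rank 1.\<close>
  have "\<rho> x \<le> \<rho> (top_of P)" if "x \<in> Field P" for x
    using that by (intro rank_mono top_greatest)
  then have "coatoms (P\<inverse>) = atoms P"
    by (auto simp: coatoms_def atoms_def rank_of_converse top_of_converse) fastforce+
  then show ?thesis by (auto simp: truncation_def dual_truncation_def)
qed

section \<open>The dual truncation as a bounded graded poset\<close>

abbreviation "Q \<equiv> dual_truncation P"

lemma Field_dual_truncation: "Field Q = Field P - atoms P"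
  using refl by (auto simp: dual_truncation_def Field_def)

lemma dual_truncation_iff: "(x, y) \<in> Q \<longleftrightarrow> (x, y) \<in> P \<and> x \<notin> atoms P \<and> y \<notin> atoms P"
  by (auto simp: dual_truncation_def Field_def)

lemma bot_notin_atoms: "bot_of P \<notin> atoms P"
  by (simp add: atoms_def)

lemma is_bot_dual_truncation: "is_bot Q (bot_of P)"
  by (auto simp: is_bot_def Field_dual_truncation dual_truncation_iff bot_notin_atoms bot_least)

lemma finite_poset_dual_truncation: "finite_poset Q"
  unfolding finite_poset_def partial_order_on_def preorder_on_def
proof (intro conjI)
  show "finite (Field Q)" by (simp add: Field_dual_truncation)
  show "refl_on (Field Q) Q"
    by (auto simp: refl_on_def Field_dual_truncation dual_truncation_iff refl)
  show "Relation.trans Q"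
    by (auto simp: trans_def dual_truncation_iff intro: trans)
  show "Relation.antisym Q"
    by (auto simp: antisym_def dual_truncation_iff intro: antisym)
qed (auto simp: Field_def)

lemma rank_ge_2: "x \<in> Field Q \<Longrightarrow> x \<noteq> bot_of P \<Longrightarrow> \<rho> x \<ge> 2"
  using rank_eq_0_iff[of x] by (auto simp: Field_dual_truncation atoms_def)

text \<open>Deleting level 1 lowers every rank above it by one, and truncated subtraction keeps the
  bottom at 0. A cover of \<open>Q\<close> is either a cover of \<open>P\<close> or a jump from the
  bottom to rank 2.\<close>

lemma rank_function_dual_truncation: "rank_function Q (\<lambda>x. \<rho> x - 1)"
  unfolding rank_function_def
proof (intro conjI allI impI)
  fix b assume "is_bot Q b"
  then have "b = bot_of P"
    using is_bot_dual_truncation by (auto simp: is_bot_def dual_truncation_iff intro: antisym)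
  then show "\<rho> b - 1 = 0" by simp
next
  fix x y assume cov: "covered_by Q x y"
  then have xy: "(x, y) \<in> P" "x \<noteq> y" "x \<in> Field Q" "y \<in> Field Q"
    by (auto simp: covered_by_def dual_truncation_iff Field_def)
  \<comment> \<open>If \<open>w\<close> is an atom, then \<open>x\<close> is the bottom; otherwise
    \<open>w\<close> survives in \<open>Q\<close> and the cover forces \<open>w = x\<close>.\<close>
  obtain w where w: "(x, w) \<in> P" "covered_by P w y"
    using exists_covered_by[OF finite_poset xy(1,2)] by blast
  then have rw: "\<rho> y = \<rho> w + 1" and wy: "(w, y) \<in> P" "w \<noteq> y"
    using rank_function_rank_of by (auto simp: rank_function_def covered_by_def)
  have "y \<noteq> bot_of P" using xy rank_strict_mono[of x y] by auto
  then have y2: "\<rho> y \<ge> 2" using rank_ge_2 xy by blast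
  have eq: "w = x" if "w \<notin> atoms P"
  proof -
    have "w \<in> interval Q x y"
      using that w wy xy by (auto simp: interval_def dual_truncation_iff Field_dual_truncation)
    then show ?thesis using cov wy by (auto simp: covered_by_def)
  qed
  show "\<rho> y - 1 = \<rho> x - 1 + 1"
  proof (cases "w \<in> atoms P")
    case True
    then have "\<rho> w = 1" by (simp add: atoms_def)
    moreover have "x \<noteq> w" using True xy by (auto simp: Field_dual_truncation)
    ultimately have "\<rho> x < 1" using rank_strict_mono[OF w(1)] by simp
    then show ?thesis using rw \<open>\<rho> w = 1\<close> by simp
  next
    case False
    then show ?thesis using eq rw y2 by simp
  qed
qed

text \<open>When the top is itself an atom, \<open>P\<close> has rank 1 and only the bottom
  survives.\<close>

lemma is_top_dual_truncation:
  "is_top Q (if top_of P \<in> atoms P then bot_of P else top_of P)"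
proof (cases "top_of P \<in> atoms P")
  case True
  have "x = bot_of P" if "x \<in> Field Q" for x
  proof (rule ccontr)
    assume "x \<noteq> bot_of P"
    then have "\<rho> x \<ge> 2" using that rank_ge_2 by blast
    moreover have "\<rho> x \<le> \<rho> (top_of P)"
      using that by (intro rank_mono top_greatest) (simp add: Field_dual_truncation)
    ultimately show False using True by (simp add: atoms_def)
  qed
  then show ?thesis using True is_bot_dual_truncation by (auto simp: is_top_def is_bot_def)
next
  case False
  then show ?thesis
    by (auto simp: is_top_def Field_dual_truncation dual_truncation_iff top_greatest)
qed

lemma bounded_graded_dual_truncation: "bounded_graded Q"
  unfolding bounded_graded_def bounded_graded_poset_def
  using finite_poset_dual_truncation is_bot_dual_truncation is_top_dual_truncation
    rank_function_dual_truncation by blast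

lemma rank_of_dual_truncation: "x \<in> Field Q \<Longrightarrow> rank_of Q x = \<rho> x - 1"
  using bounded_graded.rank_of_eq[OF bounded_graded_dual_truncation rank_function_dual_truncation] .

lemma bot_of_dual_truncation: "bot_of Q = bot_of P"
  using bounded_graded.bot_of_eq[OF bounded_graded_dual_truncation is_bot_dual_truncation] .

lemma top_of_dual_truncation:
  "top_of Q = (if top_of P \<in> atoms P then bot_of P else top_of P)"
  using bounded_graded.top_of_eq[OF bounded_graded_dual_truncation is_top_dual_truncation] .

section \<open>Agreement of \<open>P\<close> and \<open>Q\<close> above a non-bottom element of
  \<open>Q\<close>\<close>

lemma above_in_dual_truncation:
  assumes "x \<in> Field Q" "x \<noteq> bot_of P" "(x, z) \<in> P"
  shows "z \<in> Field Q" "z \<noteq> bot_of P"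
  using rank_ge_2[OF assms(1,2)] rank_mono[OF assms(3)] assms(3)
  by (auto simp: Field_dual_truncation atoms_def FieldI2)

lemma interval_dual_truncation:
  assumes "x \<in> Field Q" "x \<noteq> bot_of P"
  shows "interval Q x y = interval P x y"
  using assms above_in_dual_truncation[OF assms] trans[of x _ y]
  by (auto simp: interval_def dual_truncation_iff Field_dual_truncation)

lemma mobius_dual_truncation:
  assumes "x \<in> Field Q" "x \<noteq> bot_of P"
  shows "mobius Q x y = mobius P x y"
proof (induction "card (interval P x y)" arbitrary: y rule: less_induct)
  case less
  have iff: "(x, y) \<in> Q \<longleftrightarrow> (x, y) \<in> P"
    using assms above_in_dual_truncation[OF assms] by (auto simp: dual_truncation_iff Field_dual_truncation)
  have "mobius Q x z = mobius P x z" if "(x, y) \<in> P" "z \<in> interval P x y - {y}" for z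
    using that interval_psubset(1)[OF finite_poset, of x y z] finite_interval[OF finite_poset]
    by (intro less.hyps psubset_card_mono) auto
  then show ?case
    by (subst (1 2) mobius.simps)
       (simp add: iff finite_poset finite_poset_dual_truncation interval_dual_truncation[OF assms])
qed

text \<open>Both ranks drop by one, so their difference is unchanged. From the bottom this fails,
  since its rank stays 0.\<close>

lemma aug_kernel_dual_truncation:
  assumes "x \<in> Field Q" "x \<noteq> bot_of P"
  shows "aug_kernel Q x y = aug_kernel P x y"
proof (cases "(x, y) \<in> P")
  case True
  then show ?thesis
    using above_in_dual_truncation[OF assms True] rank_ge_2[of x] rank_ge_2[of y] assms
    by (simp add: aug_kernel_def mobius_dual_truncation rank_of_dual_truncation)
next
  case False
  then show ?thesis using assms by (simp add: aug_kernel_def mobius_dual_truncation mobius_eq_0)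
qed

text \<open>The diagonal of \<open>K\<close> is 1, so a row of \<open>K G = \<delta>\<close> can be
  solved for its diagonal term.\<close>

lemma aug_interval_recursion:
  assumes "x \<in> Field P"
  shows "aug_interval P x y =
    delta x y - (\<Sum>z\<in>Field P - {x}. aug_kernel P x z * aug_interval P z y)"
proof -
  have "aug_kernel P x x = 1" using assms by (simp add: aug_kernel_def)
  then show ?thesis using aug_kernel_aug_interval[OF assms, of y] assms
    by (simp add: conv_def sum.remove[of _ x] algebra_simps)
qed

lemma aug_kernel_eq_0: "(x, y) \<notin> P \<Longrightarrow> aug_kernel P x y = 0"
  by (simp add: aug_kernel_def mobius_eq_0)

lemma aug_interval_dual_truncation:
  assumes "x \<in> Field Q" "x \<noteq> bot_of P"
  shows "aug_interval Q x y = aug_interval P x y"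
  using assms
proof (induction "card (interval P x (top_of P))" arbitrary: x rule: less_induct)
  case less
  interpret Q: bounded_graded Q by (rule bounded_graded_dual_truncation)
  have xP: "x \<in> Field P" using less.prems by (simp add: Field_dual_truncation)
  \<comment> \<open>Only atoms are dropped; none lies above \<open>x\<close>, so their kernel
    entries vanish.\<close>
  have "(\<Sum>z\<in>Field P - {x}. aug_kernel P x z * aug_interval P z y)
      = (\<Sum>z\<in>Field Q - {x}. aug_kernel P x z * aug_interval P z y)"
    using above_in_dual_truncation(1)[OF less.prems]
    by (intro sum.mono_neutral_right) (auto simp: Field_dual_truncation intro: aug_kernel_eq_0)
  also have "\<dots> = (\<Sum>z\<in>Field Q - {x}. aug_kernel Q x z * aug_interval Q z y)"
  proof (rule sum.cong)
    fix z assume z: "z \<in> Field Q - {x}"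
    show "aug_kernel P x z * aug_interval P z y = aug_kernel Q x z * aug_interval Q z y"
    proof (cases "(x, z) \<in> P")
      case True
      have "z \<in> interval P x (top_of P)"
        using True by (auto simp: interval_def intro: top_greatest FieldI2)
      then have "interval P z (top_of P) \<subset> interval P x (top_of P)"
        using z interval_psubset(2)[OF finite_poset top_greatest[OF xP]] by blast
      then have "aug_interval Q z y = aug_interval P z y"
        using above_in_dual_truncation[OF less.prems True] finite_interval[OF finite_poset]
        by (intro less.hyps psubset_card_mono) auto
      then show ?thesis using less.prems by (simp add: aug_kernel_dual_truncation)
    qed (use less.prems in \<open>simp add: aug_kernel_dual_truncation aug_kernel_eq_0\<close>)
  qed simp
  finally show ?case
    using aug_interval_recursion[OF xP] Q.aug_interval_recursion[OF less.prems(1)] by simp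
qed

section \<open>Expansion at the bottom element and the role of the atoms\<close>

lemma chow_poly_eq:
  assumes "bot_of P \<noteq> top_of P"
  shows "chow_poly P = - (\<Sum>z\<in>Field P - {bot_of P}.
    smult (mobius P (bot_of P) z) (q_int (\<rho> z)) * aug_interval P z (top_of P))"
proof -
  let ?b = "bot_of P" and ?t = "top_of P"
  let ?F = "\<lambda>z. smult (mobius P ?b z) (q_int (\<rho> z)) * aug_interval P z ?t"
  \<comment> \<open>Uses \<open>[n+1] = [n] + t^n\<close>. The \<open>t^n\<close> part sums to
    \<open>H\<close>, and the whole row of \<open>K G\<close> is 0 because bottom and top
    differ.\<close>
  have "aug_kernel P ?b z * aug_interval P z ?t
      = ?F z + rmobius P ?b z * aug_interval P z ?t" for z
    by (simp add: aug_kernel_def rmobius_def smult_add_right smult_monom distrib_right)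
  then have "conv (Field P) (aug_kernel P) (aug_interval P) ?b ?t
      = (\<Sum>z\<in>Field P. ?F z) + conv (Field P) (rmobius P) (aug_interval P) ?b ?t"
    by (simp add: conv_def sum.distrib)
  then have "chow_poly P = - (\<Sum>z\<in>Field P. ?F z)"
    using assms by (simp add: aug_kernel_aug_interval chow_poly_def chow_interval_eq_rmobius_aug
        delta_def eq_neg_iff_add_eq_0 add.commute)
  then show ?thesis by (simp add: sum.remove[of "Field P" ?b])
qed

text \<open>Unlike the defining recursion, which keeps the first argument fixed at the bottom, this
  form involves only entries starting at non-bottom elements, where \<open>P\<close> and
  \<open>Q\<close> can be compared.\<close>

lemma mobius_bot_eq:
  assumes "z \<in> Field P" "z \<noteq> bot_of P"
  shows "mobius P (bot_of P) z = - (\<Sum>w\<in>Field P - {bot_of P}. mobius P w z)"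
proof -
  have "(\<Sum>w\<in>Field P. mobius P w z) = 0"
    using zeta_mobius[OF bot_in_Field assms(1)] assms
    by (simp add: conv_def delta_def bot_least)
  then show ?thesis by (simp add: sum.remove[of "Field P" "bot_of P"])
qed

text \<open>The instances of \<open>mobius_bot_eq\<close> for \<open>P\<close> and \<open>Q\<close>
  differ exactly by the terms of the atoms.\<close>

lemma mobius_bot_dual_truncation:
  assumes "z \<in> Field Q" "z \<noteq> bot_of P"
  shows "mobius Q (bot_of P) z = mobius P (bot_of P) z + (\<Sum>a\<in>atoms P. mobius P a z)"
proof -
  interpret Q: bounded_graded Q by (rule bounded_graded_dual_truncation)
  have "mobius Q (bot_of P) z = - (\<Sum>w\<in>Field Q - {bot_of P}. mobius P w z)"
    using Q.mobius_bot_eq[of z] assms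
    by (simp add: bot_of_dual_truncation mobius_dual_truncation)
  moreover have "Field P - {bot_of P} = (Field Q - {bot_of P}) \<union> atoms P"
    using bot_notin_atoms by (auto simp: Field_dual_truncation atoms_def)
  moreover have "(\<Sum>w\<in>(Field Q - {bot_of P}) \<union> atoms P. mobius P w z)
      = (\<Sum>w\<in>Field Q - {bot_of P}. mobius P w z) + (\<Sum>a\<in>atoms P. mobius P a z)"
    by (rule sum.union_disjoint) (auto simp: Field_dual_truncation atoms_def)
  ultimately show ?thesis
    using assms mobius_bot_eq[of z] by (simp add: Field_dual_truncation)
qed

text \<open>Only the bottom and \<open>a\<close> lie below an atom \<open>a\<close>. The two values
  add to 0, which later removes the atoms from the sum over \<open>P\<close>.\<close>

lemma mobius_bot_atom: "a \<in> atoms P \<Longrightarrow> mobius P (bot_of P) a = - 1"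
  and sum_mobius_atoms: "a \<in> atoms P \<Longrightarrow> (\<Sum>c\<in>atoms P. mobius P c a) = 1"
proof -
  assume a: "a \<in> atoms P"
  then have aF: "a \<in> Field P" "a \<noteq> bot_of P" "\<rho> a = 1" by (auto simp: atoms_def)
  have zero: "mobius P w a = 0" if "w \<in> Field P" "w \<noteq> bot_of P" "w \<noteq> a" for w
    using that rank_strict_mono[of w a] rank_eq_0_iff[of w] aF by (auto intro: mobius_eq_0)
  have "(\<Sum>w\<in>Field P - {bot_of P}. mobius P w a) = (\<Sum>w\<in>{a}. mobius P w a)"
    using aF zero by (intro sum.mono_neutral_right) auto
  then show "mobius P (bot_of P) a = - 1" using aF by (simp add: mobius_bot_eq)
  have "(\<Sum>w\<in>atoms P. mobius P w a) = (\<Sum>w\<in>{a}. mobius P w a)"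
  proof (rule sum.mono_neutral_right)
    show "\<forall>w\<in>atoms P - {a}. mobius P w a = 0"
      using bot_notin_atoms by (intro ballI zero) (auto simp: atoms_def)
  qed (use a in \<open>auto simp: atoms_def\<close>)
  then show "(\<Sum>c\<in>atoms P. mobius P c a) = 1" using aF by simp
qed

text \<open>As \<open>a\<close> has rank 1, the length \<open>\<rho> z - 1 + 1\<close> is the one in
  \<open>chow_poly_eq\<close>, so atom rows can be added to that expansion.\<close>

lemma aug_kernel_atom:
  assumes "a \<in> atoms P"
  shows "aug_kernel P a z = smult (mobius P a z) (q_int (\<rho> z))"
  using assms rank_mono[of a z]
  by (cases "(a, z) \<in> P") (auto simp: aug_kernel_def atoms_def mobius_eq_0 Suc_diff_le simp del: q_int_simps)

lemma chow_poly_eq_augmented_dual_truncation: "chow_poly P = augmented_chow_poly Q"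
proof -
  interpret Q: bounded_graded Q by (rule bounded_graded_dual_truncation)
  let ?b = "bot_of P" and ?t = "top_of P"
  let ?F = "\<lambda>z. q_int (\<rho> z) * aug_interval P z ?t"
  \<comment> \<open>In the first two cases \<open>Q\<close> is a single point and both sides are
    1.\<close>
  consider "?b = ?t" | "?t \<in> atoms P" | "?b \<noteq> ?t" "?t \<notin> atoms P" by blast
  then show ?thesis
  proof cases
    case 1
    then have "chow_poly P = 1"
      unfolding chow_poly_def by (subst chow_interval.simps) (simp add: finite_poset refl)
    moreover have "augmented_chow_poly Q = 1"
      using 1 Q.aug_interval_self[OF Q.bot_in_Field]
      by (simp add: Q.augmented_chow_poly_eq bot_of_dual_truncation top_of_dual_truncation)
    ultimately show ?thesis by simp
  next
    case 2
    have "z = ?t" if "z \<in> Field P" "z \<noteq> ?b" for z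
      using 2 that rank_strict_mono[OF top_greatest, of z] rank_eq_0_iff[of z]
      by (auto simp: atoms_def)
    then have "Field P - {?b} = {?t}"
      using 2 bot_notin_atoms by auto
    moreover have "?b \<noteq> ?t"
      using 2 bot_notin_atoms by metis
    moreover have "\<rho> ?t = 1"
      using 2 by (simp add: atoms_def)
    ultimately have "chow_poly P = 1"
      using 2 by (simp add: chow_poly_eq mobius_bot_atom aug_interval_self)
    moreover have "augmented_chow_poly Q = 1"
      using 2 Q.aug_interval_self[OF Q.bot_in_Field]
      by (simp add: Q.augmented_chow_poly_eq bot_of_dual_truncation top_of_dual_truncation)
    ultimately show ?thesis by simp
  next
    case 3
    define s where "s z = (\<Sum>a\<in>atoms P. mobius P a z)" for z
    \<comment> \<open>An off-diagonal entry of \<open>K G = \<delta>\<close>, because the top is not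
      an atom here.\<close>
    have "(\<Sum>z\<in>Field P. smult (mobius P a z) (?F z)) = 0" if a: "a \<in> atoms P" for a
    proof -
      have "conv (Field P) (aug_kernel P) (aug_interval P) a ?t = 0"
        using a 3 by (subst aug_kernel_aug_interval) (auto simp: atoms_def delta_def)
      then show ?thesis using a by (simp add: conv_def aug_kernel_atom)
    qed
    then have "0 = (\<Sum>a\<in>atoms P. \<Sum>z\<in>Field P. smult (mobius P a z) (?F z))"
      by simp
    also have "\<dots> = (\<Sum>z\<in>Field P. \<Sum>a\<in>atoms P. smult (mobius P a z) (?F z))"
      by (rule sum.swap)
    also have "\<dots> = (\<Sum>z\<in>Field P. smult (s z) (?F z))"
      by (simp add: s_def smult_sum)
    also have "\<dots> = (\<Sum>z\<in>Field P - {?b}. smult (s z) (?F z))"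
      by (simp add: sum.remove[of "Field P" ?b])
    finally have "chow_poly P
        = - (\<Sum>z\<in>Field P - {?b}. smult (mobius P ?b z + s z) (?F z))"
      using 3 by (simp add: chow_poly_eq smult_add_left sum.distrib)
    \<comment> \<open>At an atom the coefficient is \<open>- 1 + 1 = 0\<close>, so the sum shrinks
      to \<open>Q\<close>.\<close>
    also have "(\<Sum>z\<in>Field P - {?b}. smult (mobius P ?b z + s z) (?F z))
        = (\<Sum>z\<in>Field Q - {?b}. smult (mobius P ?b z + s z) (?F z))"
      by (intro sum.mono_neutral_right)
         (auto simp: Field_dual_truncation s_def mobius_bot_atom sum_mobius_atoms)
    also have "\<dots> = (\<Sum>z\<in>Field Q - {?b}. aug_kernel Q ?b z * aug_interval Q z ?t)"
    proof (rule sum.cong)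
      fix z assume "z \<in> Field Q - {?b}"
      then have z: "z \<in> Field Q" "z \<noteq> ?b" by auto
      \<comment> \<open>The rank lost in \<open>Q\<close> offsets the extra 1 in the kernel, so the
        q-integers of \<open>H\<close> for \<open>P\<close> and of \<open>G\<close> for
        \<open>Q\<close> coincide.\<close>
      have "Suc (rank_of Q z - rank_of Q ?b) = \<rho> z"
        using z rank_ge_2[OF z] Q.rank_bot
        by (simp add: rank_of_dual_truncation bot_of_dual_truncation)
      then show "smult (mobius P ?b z + s z) (?F z) = aug_kernel Q ?b z * aug_interval Q z ?t"
        using z by (simp add: aug_kernel_def mobius_bot_dual_truncation s_def
            aug_interval_dual_truncation del: q_int_simps)
    qed simp
    also have "- \<dots> = aug_interval Q ?b ?t"
      using 3 Q.aug_interval_recursion[OF Q.bot_in_Field, of ?t]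
      by (simp add: bot_of_dual_truncation delta_def)
    finally show ?thesis
      using 3 by (simp add: Q.augmented_chow_poly_eq bot_of_dual_truncation top_of_dual_truncation)
  qed
qed

end

theorem theorem1p2:
  fixes P :: "'a rel"
  assumes "bounded_graded_poset P"
  shows "chow_poly P = augmented_chow_poly (dual_truncation P) \<and>
         augmented_chow_poly (dual_truncation P) = augmented_chow_poly (truncation (P\<inverse>))"
proof -
  interpret bounded_graded P by standard (rule assms)
  \<comment> \<open>Self-duality of the augmented Chow polynomial is applied to the dual truncation,
    whose converse is \<open>truncation (P\<inverse>)\<close>.\<close>
  interpret Q: bounded_graded "dual_truncation P" by (rule bounded_graded_dual_truncation)
  show ?thesis
    by (simp add: chow_poly_eq_augmented_dual_truncation truncation_converse
        Q.augmented_chow_poly_converse)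
qed

end
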